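(* Consider the per-sample training objective $\varphi^{[j]}(\mathbf{W},\mathbf{b})=\operatorname{loss}(\operatorname{net}(u^{[j]},(\mathbf{W},\mathbf{b})),v^{[j]})$ of a feed forward ReLU network with biases, with evaluation procedure $(f^{[j]},c^{[j]})$ as given in the context. For every $j\in\{1,\dots,J\}$ and all parameters $(\mathbf{W},\mathbf{b})$, the procedure $(f^{[j]},c^{[j]})$ satisfies the linear independence kink qualification (LIKQ) at $(\mathbf{W},\mathbf{b})$. Consequently, arbitrary choices in $[-1,1]$ for the derivative of $|\cdot|$ at $0$ in the backward propagation yield Clarke generalized gradients: with $\mathring{\sigma}=\operatorname{sign}(\mathbf{z})$ the signature of sample $j$ at $(\mathbf{W},\mathbf{b})$, for every $\xi\in[-1,1]^s$ with $\xi_k=\mathring{\sigma}_k$ whenever $\mathring{\sigma}_k\neq0$, one has $\nabla\varphi^{[j]}_\xi(\mathbf{W},\mathbf{b})\in\partial_C\varphi^{[j]}(\mathbf{W},\mathbf{b})$.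
   Context: Network. Let $J,N,M,T\in\mathbb{N}$ (positive integers), let $(u^{[j]},v^{[j]})\in\mathbb{R}^N\times\mathbb{R}^M$, $j=1,\dots,J$, be samples and labels, let $N_1,\dots,N_T\in\mathbb{N}$ be the hidden layer widths, $N_0=N$, $N_{T+1}=M$. The parameters are $\mathbf{W}=(W^{(1)},\dots,W^{(T+1)})$ with $W^{(t)}\in\mathbb{R}^{N_t\times N_{t-1}}$ and $\mathbf{b}=(b^{(1)},\dots,b^{(T+1)})$ with $b^{(t)}\in\mathbb{R}^{N_t}$, all independent variables; $x=(\mathbf{W},\mathbf{b})$ is identified with a vector in $\mathbb{R}^n$. For $u\in\mathbb{R}^N$ set $u^{(0)}=u$ and, for $t=1,\dots,T$, $z^{(t)}=W^{(t)}u^{(t-1)}+b^{(t)}$, $u^{(t)}=\operatorname{relu}(z^{(t)})=\tfrac12(z^{(t)}+|z^{(t)}|)$ (componentwise); the output is $\operatorname{net}(u,(\mathbf{W},\mathbf{b}))=h(W^{(T+1)}u^{(T)}+b^{(T+1)})$. Here $h:\mathbb{R}^{M}\to\mathbb{R}^M$ is smooth and $\operatorname{loss}:\mathbb{R}^M\times\mathbb{R}^M\to\mathbb{R}$ is such that $\operatorname{loss}(\cdot,v)$ is $C^2$ for each $v$. Evaluation procedure. Let $s=N_1+\dots+N_T$ and write $\mathbf{y}=(y^{(1)},\dots,y^{(T)})$, $\mathbf{z}=(z^{(1)},\dots,z^{(T)})\in\mathbb{R}^{N_1}\times\dots\times\mathbb{R}^{N_T}=\mathbb{R}^s$. Define $f^{[j]}((\mathbf{W},\mathbf{b}),\mathbf{y},\mathbf{z})=\operatorname{loss}\big(h(\tfrac12W^{(T+1)}(z^{(T)}+y^{(T)})+b^{(T+1)}),v^{[j]}\big)$,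 and let $c^{[j]}((\mathbf{W},\mathbf{b}),\mathbf{y},\mathbf{z})\in\mathbb{R}^s$ have blocks $W^{(1)}u^{[j]}+b^{(1)}$ (first block) and $\tfrac12W^{(t)}(z^{(t-1)}+y^{(t-1)})+b^{(t)}$ for $t=2,\dots,T$. Then $\mathbf{z}=c^{[j]}(x,|\mathbf{z}|,\mathbf{z})$ has a unique solution $\mathbf{z}[x]$ for every $x=(\mathbf{W},\mathbf{b})$ (the pre-activations for $u=u^{[j]}$), and $\varphi^{[j]}(x)=f^{[j]}(x,|\mathbf{z}[x]|,\mathbf{z}[x])$. Smooth models. For $\xi\in[-1,1]^s$, $\Xi=\operatorname{diag}(\xi)$, let $\mathbf{z}_\xi[x]$ be the unique solution of $\mathbf{z}_\xi=c^{[j]}(x,\Xi\mathbf{z}_\xi,\mathbf{z}_\xi)$ and $\varphi^{[j]}_\xi(x)=f^{[j]}(x,\Xi\mathbf{z}_\xi[x],\mathbf{z}_\xi[x])$, a $C^2$ function. LIKQ. At a point $x$, let $\mathbf{z}=\mathbf{z}[x]$, $\mathring{\sigma}=\operatorname{sign}(\mathbf{z})\in\{-1,0,1\}^s$ (componentwise), $\mathring{\Sigma}=\operatorname{diag}(\mathring{\sigma})$, $\mathring{\alpha}=\{i\mid\mathring{\sigma}_i=0\}$, let $P_{\mathring{\alpha}}\in\mathbb{R}^{|\mathring{\alpha}|\times s}$ have rows $e_i^T$, $i\in\mathring{\alpha}$, and let $Z\in\mathbb{R}^{s\times n}$, $L,M\in\mathbb{R}^{s\times s}$ be the Jacobians of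 $c^{[j]}$ with respect to $x$, $\mathbf{y}$, $\mathbf{z}$ respectively at $(x,|\mathbf{z}|,\mathbf{z})$. LIKQ holds at $x$ if $P_{\mathring{\alpha}}(I_s-L\mathring{\Sigma}-M)^{-1}Z$ has full row rank $|\mathring{\alpha}|$. Clarke gradients. For locally Lipschitz $\varphi$, $\partial_C\varphi(x)$ is the convex hull of the set of all limits $\lim_k\nabla\varphi(x_k)$ with $x_k\to x$ and $\varphi$ differentiable at every $x_k$. *)

theory Defs
  imports "HOL-Analysis.Analysis"
begin

section \<open>Differentiability classes and Clarke gradients\<close>

text \<open>Everywhere defined maps of class \<open>C\<^sup>k\<close> on a Euclidean space: all iterated directional
  derivatives up to order \<open>k\<close> exist as Frechet derivatives and are continuous.\<close>

primrec C_k :: "nat \<Rightarrow> ('a::euclidean_space \<Rightarrow> 'b::real_normed_vector) \<Rightarrow> bool" where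
  "C_k 0 f \<longleftrightarrow> continuous_on UNIV f"
| "C_k (Suc k) f \<longleftrightarrow> (\<forall>x. f differentiable (at x)) \<and>
     (\<forall>v. C_k k (\<lambda>x. frechet_derivative f (at x) v))"

definition smooth :: "('a::euclidean_space \<Rightarrow> 'b::real_normed_vector) \<Rightarrow> bool" where
  "smooth f \<longleftrightarrow> (\<forall>k. C_k k f)"

definition clarke_gradients :: "('a::euclidean_space \<Rightarrow> real) \<Rightarrow> 'a \<Rightarrow> 'a set" where
  "clarke_gradients f x = convex hull
     {g. \<exists>X G. X \<longlonglongrightarrow> x \<and> (\<forall>k. GDERIV f (X k) :> G k) \<and> G \<longlonglongrightarrow> g}"


section \<open>Abs-normal evaluation procedures\<close>

text \<open>Here \<open>f x y z\<close> and \<open>c x y z\<close> are functions of the parameters \<open>x\<close>, of \<open>y\<close> (for which the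
  absolute value of \<open>z\<close> is substituted) and of the switching vector \<open>z\<close>. On \<open>real ^ 'h\<close> the
  library's \<open>\<bar>z\<bar>\<close> is the componentwise absolute value, whereas its \<open>sgn\<close> is \<open>z / norm z\<close>; hence
  the separate componentwise signature.\<close>

definition diag :: "real ^ 'h \<Rightarrow> real ^ 'h ^ 'h" where
  "diag d = (\<chi> i j. if i = j then d $ i else 0)"

definition signature :: "real ^ 'h \<Rightarrow> real ^ 'h" where
  "signature z = (\<chi> i. sgn (z $ i))"

definition switching ::
  "(real ^ 'n \<Rightarrow> real ^ 'h \<Rightarrow> real ^ 'h \<Rightarrow> real ^ 'h) \<Rightarrow> real ^ 'n \<Rightarrow> real ^ 'h::finite" where
  "switching c x = (THE z. z = c x \<bar>z\<bar> z)"

definition smooth_switching ::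
  "(real ^ 'n \<Rightarrow> real ^ 'h \<Rightarrow> real ^ 'h \<Rightarrow> real ^ 'h) \<Rightarrow> real ^ 'h \<Rightarrow> real ^ 'n \<Rightarrow> real ^ 'h::finite" where
  "smooth_switching c \<xi> x = (THE z. z = c x (diag \<xi> *v z) z)"

definition smooth_model ::
  "(real ^ 'n \<Rightarrow> real ^ 'h \<Rightarrow> real ^ 'h \<Rightarrow> real) \<Rightarrow>
   (real ^ 'n \<Rightarrow> real ^ 'h \<Rightarrow> real ^ 'h \<Rightarrow> real ^ 'h) \<Rightarrow>
   real ^ 'h \<Rightarrow> real ^ 'n \<Rightarrow> real" where
  "smooth_model f c \<xi> x =
     (let z = smooth_switching c \<xi> x in f x (diag \<xi> *v z) z)"

text \<open>The number of rows of \<open>P\<^sub>\<alpha>\<close> depends on the point, so it cannot be a type. The matrix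
  \<open>row_selection \<alpha>\<close> has row \<open>e\<^sub>i\<^sup>T\<close> in position \<open>i\<close> for \<open>i \<in> \<alpha>\<close> and zero rows elsewhere; a product
  \<open>row_selection \<alpha> ** A\<close> is thus \<open>P\<^sub>\<alpha> A\<close> padded with zero rows, and has the same rank.\<close>

definition row_selection :: "'h set \<Rightarrow> real ^ 'h ^ 'h" where
  "row_selection \<alpha> = (\<chi> i. if i \<in> \<alpha> then axis i 1 else 0)"

definition LIKQ ::
  "(real ^ 'n \<Rightarrow> real ^ 'h \<Rightarrow> real ^ 'h \<Rightarrow> real ^ 'h) \<Rightarrow> real ^ 'n \<Rightarrow> bool" where
  "LIKQ c x \<longleftrightarrow>
     (let z = switching c x;
          \<sigma> = signature z;
          \<alpha> = {i. \<sigma> $ i = 0};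
          Z = jacobian (\<lambda>x'. c x' \<bar>z\<bar> z) (at x);
          L = jacobian (\<lambda>y. c x y z) (at \<bar>z\<bar>);
          M = jacobian (\<lambda>z'. c x \<bar>z\<bar> z') (at z)
      in rank (row_selection \<alpha> ** matrix_inv (mat 1 - L ** diag \<sigma> - M) ** Z) = card \<alpha>)"


section \<open>Feed forward ReLU networks with biases\<close>

text \<open>The components of input, hidden and output vectors are indexed by the finite types \<open>'i\<close>,
  \<open>'h\<close>, \<open>'m\<close>, so that the space of all hidden pre-activations is \<open>real ^ 'h\<close>. The map \<open>layer\<close>
  assigns to each hidden neuron its layer in \<open>{1..T}\<close>: the block \<open>z\<^sup>(\<^sup>t\<^sup>)\<close> of \<open>z\<close> consists of the
  components \<open>z $ k\<close> with \<open>layer k = t\<close>.\<close>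

datatype ('i, 'h, 'm) neuron = In 'i | Hid 'h | Out 'm

primrec level :: "nat \<Rightarrow> ('h \<Rightarrow> nat) \<Rightarrow> ('i, 'h, 'm) neuron \<Rightarrow> nat" where
  "level T layer (In i) = 0"
| "level T layer (Hid k) = layer k"
| "level T layer (Out m) = Suc T"

text \<open>\<open>Weight p q\<close> names the entry of \<open>W\<^sup>(\<^sup>t\<^sup>)\<close> in the row of \<open>p\<close> (layer \<open>t\<close>) and the column of \<open>q\<close>
  (layer \<open>t - 1\<close>), and \<open>Bias p\<close> the entry of \<open>b\<^sup>(\<^sup>t\<^sup>)\<close> belonging to \<open>p\<close>. A bijection \<open>idx\<close> from these
  names to \<open>'n\<close> identifies the tuple of all weights and biases with a vector in \<open>real ^ 'n\<close>.\<close>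

datatype 'p parameter = Weight 'p 'p | Bias 'p

definition parameters :: "nat \<Rightarrow> ('h \<Rightarrow> nat) \<Rightarrow> ('i, 'h, 'm) neuron parameter set" where
  "parameters T layer =
     {Weight p q |p q. level T layer p = Suc (level T layer q)} \<union>
     {Bias p |p. level T layer p \<ge> 1}"

definition weight :: "('p parameter \<Rightarrow> 'n) \<Rightarrow> real ^ 'n \<Rightarrow> 'p \<Rightarrow> 'p \<Rightarrow> real" where
  "weight idx x p q = x $ idx (Weight p q)"

definition bias :: "('p parameter \<Rightarrow> 'n) \<Rightarrow> real ^ 'n \<Rightarrow> 'p \<Rightarrow> real" where
  "bias idx x p = x $ idx (Bias p)"

definition relu :: "real \<Rightarrow> real" where
  "relu a = (a + \<bar>a\<bar>) / 2"

text \<open>\<open>activation T layer idx x u t p\<close> is the component \<open>p\<close> of \<open>u\<^sup>(\<^sup>t\<^sup>)\<close>; only its values at neurons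
  \<open>p\<close> of level \<open>t\<close> are meaningful, and only these are used.\<close>

primrec activation ::
  "nat \<Rightarrow> ('h \<Rightarrow> nat) \<Rightarrow> (('i, 'h, 'm) neuron parameter \<Rightarrow> 'n) \<Rightarrow> real ^ 'n \<Rightarrow> real ^ 'i \<Rightarrow>
   nat \<Rightarrow> ('i, 'h, 'm) neuron \<Rightarrow> real" where
  "activation T layer idx x u 0 = (\<lambda>p. case p of In i \<Rightarrow> u $ i | _ \<Rightarrow> 0)"
| "activation T layer idx x u (Suc t) = (\<lambda>p. relu
     ((\<Sum>q | level T layer q = t. weight idx x p q * activation T layer idx x u t q)
      + bias idx x p))"

definition net ::
  "nat \<Rightarrow> ('h \<Rightarrow> nat) \<Rightarrow> (('i, 'h, 'm) neuron parameter \<Rightarrow> 'n) \<Rightarrow> (real ^ 'm \<Rightarrow> real ^ 'm) \<Rightarrow>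
   real ^ 'i \<Rightarrow> real ^ 'n \<Rightarrow> real ^ 'm" where
  "net T layer idx h u x = h (\<chi> m.
     (\<Sum>q | level T layer q = T. weight idx x (Out m) q * activation T layer idx x u T q)
     + bias idx x (Out m))"

definition net_f ::
  "nat \<Rightarrow> ('h \<Rightarrow> nat) \<Rightarrow> (('i, 'h::finite, 'm) neuron parameter \<Rightarrow> 'n) \<Rightarrow>
   (real ^ 'm \<Rightarrow> real ^ 'm) \<Rightarrow> (real ^ 'm \<Rightarrow> real ^ 'm \<Rightarrow> real) \<Rightarrow> real ^ 'm \<Rightarrow>
   real ^ 'n \<Rightarrow> real ^ 'h \<Rightarrow> real ^ 'h \<Rightarrow> real" where
  "net_f T layer idx h loss v x y z = loss (h (\<chi> m.
     1/2 * (\<Sum>k | layer k = T. weight idx x (Out m) (Hid k) * (z $ k + y $ k))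
     + bias idx x (Out m))) v"

definition net_c ::
  "('h \<Rightarrow> nat) \<Rightarrow> (('i::finite, 'h::finite, 'm) neuron parameter \<Rightarrow> 'n) \<Rightarrow> real ^ 'i \<Rightarrow>
   real ^ 'n \<Rightarrow> real ^ 'h \<Rightarrow> real ^ 'h \<Rightarrow> real ^ 'h" where
  "net_c layer idx u x y z = (\<chi> k.
     (if layer k = 1
      then (\<Sum>i\<in>UNIV. weight idx x (Hid k) (In i) * u $ i)
      else 1/2 * (\<Sum>l | layer l = layer k - 1. weight idx x (Hid k) (Hid l) * (z $ l + y $ l)))
     + bias idx x (Hid k))"

end

theory Submission
  imports Defs
begin

text \<open>Each hidden bias enters exactly one component of \<open>c\<close>, with coefficient one. Hence the Jacobian of
  \<open>c\<close> in the parameters has a right inverse; as \<open>I - L \<Sigma> - M\<close> is unitriangular with respect to the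
  layers, LIKQ follows. For the same reason the pre-activations can be prescribed by moving the
  biases alone: for \<open>\<sigma> \<in> {-1, 1}\<^sup>s\<close> agreeing with the signature off the kinks there are points
  tending to \<open>x\<close> near which the objective coincides with the smooth model of \<open>\<sigma>\<close>, so the gradient of
  that model at \<open>x\<close> is a limit of gradients. For admissible \<open>\<xi>\<close> the point \<open>z\<close> does not depend on \<open>\<xi>\<close>,
  and since a path through the network visits a neuron at most once, the gradient at \<open>x\<close> is affine
  in each kink coordinate of \<open>\<xi>\<close>; it is therefore a convex combination of the gradients at the
  vertices.\<close>

section \<open>Triangular systems and ranks\<close>

text \<open>Components in one layer are determined by strictly lower layers, so the equation is
  solved layer by layer. Besides both switching vectors, this also yields the injectivity needed for
  LIKQ.\<close>

lemma triangular_fixpoint: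
  fixes F :: "real ^ 'h \<Rightarrow> real ^ 'h::finite" and layer :: "'h \<Rightarrow> nat"
  assumes F: "\<And>k z z'. (\<And>l. layer l < layer k \<Longrightarrow> z $ l = z' $ l) \<Longrightarrow> F z $ k = F z' $ k"
  shows "\<exists>!z. z = F z"
proof -
  have "\<exists>z. \<forall>k. layer k < n \<longrightarrow> z $ k = F z $ k" for n
  proof (induction n)
    case (Suc n)
    then obtain z where z: "\<And>k. layer k < n \<Longrightarrow> z $ k = F z $ k" by blast
    \<comment> \<open>The solved layers are kept. For layer \<open>n\<close> the value
      \<open>F z\<close> is already final, since it reads only solved layers.\<close>
    define z' where "z' = (\<chi> k. if layer k < n then z $ k else F z $ k)"
    have "z' $ k = F z' $ k" if "layer k < Suc n" for k
    proof -
      have "F z' $ k = F z $ k"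
        using that by (intro F) (simp add: z'_def)
      then show ?thesis
        using z by (simp add: z'_def)
    qed
    then show ?case by blast
  qed simp
  \<comment> \<open>With \<open>n\<close> beyond the highest layer, the partial solution covers
    every component.\<close>
  then obtain z where z: "\<And>k. layer k < Suc (Max (range layer)) \<Longrightarrow> z $ k = F z $ k"
    by blast
  show ?thesis
  proof
    show "z = F z"
      using z by (simp add: vec_eq_iff less_Suc_eq_le)
  next
    fix z'
    assume z': "z' = F z'"
    have "z' $ k = z $ k" for k
    proof (induction "layer k" arbitrary: k rule: less_induct)
      case less
      have "F z' $ k = F z $ k"
        using less by (intro F) simp
      then show ?case
        using z[of k] z' by (simp add: less_Suc_eq_le)
    qed
    then show "z' = z"
      by (simp add: vec_eq_iff)
  qed
qed

text \<open>A right inverse makes \<open>B\<close> surjective, hence \<open>A ** B\<close> and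
  \<open>A\<close> have the same range.\<close>

lemma rank_mult_right_invertible:
  fixes A :: "real ^ 'b ^ 'a" and B :: "real ^ 'c ^ 'b"
  assumes "B ** C = mat 1"
  shows "rank (A ** B) = rank A"
proof -
  have "A *v y \<in> range (\<lambda>x. (A ** B) *v x)" for y
  proof
    show "A *v y = (A ** B) *v (C *v y)"
      by (metis assms matrix_vector_mul_assoc matrix_vector_mul_lid)
  qed simp
  moreover have "(A ** B) *v x \<in> range (\<lambda>x. A *v x)" for x
    by (simp add: matrix_vector_mul_assoc [symmetric])
  ultimately have "range (\<lambda>x. (A ** B) *v x) = range (\<lambda>x. A *v x)"
    by blast
  then show ?thesis
    by (simp add: rank_dim_range)
qed

text \<open>The range is the coordinate subspace spanned by the unit vectors with index in
  \<alpha>.\<close>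

lemma rank_row_selection: "rank (row_selection \<alpha> :: real ^ 'h ^ 'h::finite) = card \<alpha>"
proof -
  have mv: "row_selection \<alpha> *v x = (\<Sum>i\<in>\<alpha>. x $ i *\<^sub>R axis i 1)" for x :: "real ^ 'h"
  proof -
    have "(row_selection \<alpha> *v x) $ i = (if i \<in> \<alpha> then x $ i else 0)" for i
      using inner_axis[of x i 1] inner_axis[of x i 0]
      by (simp add: row_selection_def matrix_vector_mul_component inner_commute)
    moreover have "(\<Sum>j\<in>\<alpha>. x $ j *\<^sub>R axis j (1::real)) $ i = (if i \<in> \<alpha> then x $ i else 0)" for i
      by (simp add: axis_def if_distrib cong: if_cong)
    ultimately show ?thesis
      by (simp add: vec_eq_iff)
  qed
  define E where "E = (\<lambda>i::'h. axis i (1::real)) ` \<alpha>"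
  have inj: "inj_on (\<lambda>i::'h. axis i (1::real)) \<alpha>"
    by (auto simp: inj_on_def axis_eq_axis)
  have ind: "independent E"
    by (rule independent_mono[OF independent_Basis]) (auto simp: E_def axis_in_Basis_iff)
  have "range (\<lambda>x. row_selection \<alpha> *v x) = span E"
  proof
    show "range (\<lambda>x. row_selection \<alpha> *v x) \<subseteq> span E"
      unfolding E_def by (auto simp: mv intro!: span_sum span_scale intro: span_base)
    have "E \<subseteq> range (\<lambda>x. row_selection \<alpha> *v x)"
    proof
      fix e
      assume "e \<in> E"
      then obtain i where i: "i \<in> \<alpha>" "e = axis i 1"
        by (auto simp: E_def)
      have "row_selection \<alpha> *v axis i 1 = (\<Sum>j\<in>\<alpha>. if j = i then axis i 1 else 0)"
        unfolding mv by (intro sum.cong) (auto simp: axis_def)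
      then have "row_selection \<alpha> *v axis i 1 = axis i 1"
        using i by simp
      then show "e \<in> range (\<lambda>x. row_selection \<alpha> *v x)"
        using i by (metis rangeI)
    qed
    then show "span E \<subseteq> range (\<lambda>x. row_selection \<alpha> *v x)"
      by (intro span_minimal) 
        (auto intro!: linear_subspace_image[OF matrix_vector_mul_linear] subspace_UNIV)
  qed
  then show ?thesis
    using ind inj by (simp add: rank_dim_range dim_eq_card_independent E_def card_image)
qed

text \<open>Since \<open>c\<close> is affine in each of its three arguments separately, all
  Jacobians in LIKQ are read off from this.\<close>

lemma frechet_derivative_affine:
  fixes f :: "'a::euclidean_space \<Rightarrow> 'b::real_normed_vector"
  assumes "linear A" and "\<And>d. f (x + d) = f x + A d"
  shows "frechet_derivative f (at x) = A"
proof -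
  have "f = (\<lambda>y. f x + A (y - x))"
    using assms(2) by (metis add.commute diff_add_cancel)
  moreover have "((\<lambda>y. f x + A (y - x)) has_derivative A) (at x)"
    by (auto intro!: derivative_eq_intros
        bounded_linear.has_derivative[OF linear_linear[THEN iffD2, OF assms(1)]]
        simp: linear_diff[OF assms(1)] linear_0[OF assms(1)])
  ultimately show ?thesis
    by (metis frechet_derivative_at)
qed

section \<open>Continuously differentiable functions\<close>

text \<open>The gradient is an explicit argument so that recursions for it can be stated; its
  continuity is what permits passing to limits in the Clarke gradient.\<close>

definition has_C1_gradient :: "('a::euclidean_space \<Rightarrow> real) \<Rightarrow> ('a \<Rightarrow> 'a) \<Rightarrow> bool" where
  "has_C1_gradient f g \<longleftrightarrow> (\<forall>x. GDERIV f x :> g x) \<and> continuous_on UNIV g"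

lemma has_C1_gradient_continuous:
  "has_C1_gradient f g \<Longrightarrow> continuous_on UNIV f"
  unfolding has_C1_gradient_def gderiv_def
  by (meson continuous_at_imp_continuous_on has_derivative_continuous)

lemma has_C1_gradient_unique:
  assumes "has_C1_gradient f g" and "has_C1_gradient f g'"
  shows "g x = g' x"
proof -
  have "(\<lambda>d. d \<bullet> g x) = (\<lambda>d. d \<bullet> g' x)"
    using assms unfolding has_C1_gradient_def gderiv_def by (blast intro: has_derivative_unique)
  then show ?thesis
    by (metis inner_commute vector_eq_rdot)
qed

lemma has_C1_gradient_const: "has_C1_gradient (\<lambda>x. a) (\<lambda>x. 0)"
  by (simp add: has_C1_gradient_def GDERIV_const)

lemma has_C1_gradient_nth: "has_C1_gradient (\<lambda>x :: real ^ 'n. x $ i) (\<lambda>x. axis i 1)"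
  unfolding has_C1_gradient_def gderiv_def
  by (auto simp: inner_axis intro!: derivative_eq_intros bounded_linear_imp_has_derivative bounded_linear_vec_nth)

lemma has_C1_gradient_add:
  "has_C1_gradient f f' \<Longrightarrow> has_C1_gradient g g' \<Longrightarrow>
    has_C1_gradient (\<lambda>x. f x + g x) (\<lambda>x. f' x + g' x)"
  by (auto simp: has_C1_gradient_def intro!: GDERIV_add continuous_intros)

lemma has_C1_gradient_mult:
  assumes "has_C1_gradient f f'" and "has_C1_gradient g g'"
  shows "has_C1_gradient (\<lambda>x. f x * g x) (\<lambda>x. f x *\<^sub>R g' x + g x *\<^sub>R f' x)"
  using assms has_C1_gradient_continuous[OF assms(1)] has_C1_gradient_continuous[OF assms(2)]
  by (auto simp: has_C1_gradient_def intro!: GDERIV_mult continuous_intros)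

lemma has_C1_gradient_sum:
  assumes "\<And>i. i \<in> S \<Longrightarrow> has_C1_gradient (f i) (g i)"
  shows "has_C1_gradient (\<lambda>x. \<Sum>i\<in>S. f i x) (\<lambda>x. \<Sum>i\<in>S. g i x)"
  using assms
  by (induction S rule: infinite_finite_induct)
    (auto intro: has_C1_gradient_const has_C1_gradient_add)

text \<open>Chain rule with the inner map given by components. The resulting gradient is linear in
  the inner gradients \<open>g m\<close>, which the kink combinations exploit.\<close>

lemma has_C1_gradient_compose:
  fixes o' :: "'a::euclidean_space \<Rightarrow> real ^ 'm"
  assumes F: "has_C1_gradient F F'" and g: "\<And>m. has_C1_gradient (\<lambda>x. o' x $ m) (g m)"
  shows "has_C1_gradient (\<lambda>x. F (o' x)) (\<lambda>x. \<Sum>m\<in>UNIV. F' (o' x) $ m *\<^sub>R g m x)"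
proof -
  have "(o' has_derivative (\<lambda>d. \<chi> m. d \<bullet> g m x)) (at x)" for x
    using g unfolding has_C1_gradient_def gderiv_def
    by (subst has_derivative_componentwise_within) (auto simp: Basis_vec_def inner_axis)
  then have "((\<lambda>x. F (o' x)) has_derivative (\<lambda>d. (\<chi> m. d \<bullet> g m x) \<bullet> F' (o' x))) (at x)" for x
    using F has_derivative_compose unfolding has_C1_gradient_def gderiv_def by blast
  moreover have "(\<chi> m. d \<bullet> g m x) \<bullet> F' (o' x) = d \<bullet> (\<Sum>m\<in>UNIV. F' (o' x) $ m *\<^sub>R g m x)" for d x
    by (simp add: inner_vec_def inner_sum_right mult.commute)
  moreover have "continuous_on UNIV o'"
    using continuous_on_vec_lambda[of UNIV "\<lambda>m x. o' x $ m"] has_C1_gradient_continuous[OF g]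
    by simp
  moreover from this have "continuous_on UNIV (\<lambda>x. F' (o' x))"
    using F continuous_on_compose2[of UNIV F' UNIV o'] by (auto simp: has_C1_gradient_def)
  ultimately show ?thesis
    using g unfolding has_C1_gradient_def gderiv_def
    by (auto intro!: continuous_intros)
qed


section \<open>From the classes \<open>C_k\<close> to continuous gradients\<close>

lemma C_k_continuous: "C_k k f \<Longrightarrow> continuous_on UNIV f"
  by (cases k) (auto intro: differentiable_imp_continuous_on differentiable_at_imp_differentiable_on)

text \<open>The gradient is assembled from the derivatives of the composite in the basis
  directions.\<close>

lemma C_k_compose_has_C1_gradient:
  fixes f :: "'b::euclidean_space \<Rightarrow> real" and h :: "'a::euclidean_space \<Rightarrow> 'b"
  assumes f: "C_k (Suc k) f" and h: "C_k (Suc l) h"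
  shows "\<exists>F'. has_C1_gradient (\<lambda>a. f (h a)) F'"
proof
  let ?Df = "\<lambda>b. frechet_derivative f (at b)" and ?Dh = "\<lambda>a. frechet_derivative h (at a)"
  let ?D = "\<lambda>a v. ?Df (h a) (?Dh a v)"
  have Df: "(f has_derivative ?Df b) (at b)" for b
    using f by (simp add: frechet_derivative_works)
  have Dh: "(h has_derivative ?Dh a) (at a)" for a
    using h by (simp add: frechet_derivative_works)
  have D: "((\<lambda>a. f (h a)) has_derivative ?D a) (at a)" for a
    using has_derivative_compose[OF Dh Df] .
  have rep: "?D a d = d \<bullet> (\<Sum>b\<in>Basis. ?D a b *\<^sub>R b)" for a d
  proof -
    have "?D a d = ?D a (\<Sum>b\<in>Basis. (d \<bullet> b) *\<^sub>R b)"
      by (simp add: euclidean_representation)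
    also have "\<dots> = (\<Sum>b\<in>Basis. (d \<bullet> b) * ?D a b)"
      by (simp add: linear_sum[OF has_derivative_linear[OF D]]
          linear_scale[OF has_derivative_linear[OF D]] del: euclidean_representation)
    finally show ?thesis
      by (simp add: inner_sum_right mult.commute)
  qed
  have D': "((\<lambda>a. f (h a)) has_derivative (\<lambda>d. d \<bullet> (\<Sum>b\<in>Basis. ?D a b *\<^sub>R b))) (at a)" for a
    unfolding rep [symmetric] by (rule D)
  \<comment> \<open>\<open>C_k\<close> gives continuity of derivatives in a fixed direction only,
    whereas the direction \<open>?Dh a v\<close> moves with \<open>a\<close>. Expanding it in the
    basis leaves fixed directions with continuous coefficients.\<close>
  have sum: "?D a v = (\<Sum>e\<in>Basis. (?Dh a v \<bullet> e) * ?Df (h a) e)" for a v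
  proof -
    have "?D a v = ?Df (h a) (\<Sum>e\<in>Basis. (?Dh a v \<bullet> e) *\<^sub>R e)"
      by (simp add: euclidean_representation)
    also have "\<dots> = (\<Sum>e\<in>Basis. (?Dh a v \<bullet> e) * ?Df (h a) e)"
      by (simp add: linear_sum[OF has_derivative_linear[OF Df]]
          linear_scale[OF has_derivative_linear[OF Df]] del: euclidean_representation)
    finally show ?thesis .
  qed
  have "continuous_on UNIV (\<lambda>a. ?Df (h a) e)" for e
    using f C_k_continuous[of k "\<lambda>b. ?Df b e"]
    by (intro continuous_on_compose2[OF _ C_k_continuous[OF h], of UNIV "\<lambda>b. ?Df b e"]) simp_all
  moreover have "continuous_on UNIV (\<lambda>a. ?Dh a v)" for v
    using h C_k_continuous[of l "\<lambda>b. ?Dh b v"] by simp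
  ultimately have "continuous_on UNIV (\<lambda>a. \<Sum>b\<in>Basis. ?D a b *\<^sub>R b)"
    unfolding sum by (intro continuous_intros)
  then show "has_C1_gradient (\<lambda>a. f (h a)) (\<lambda>a. \<Sum>b\<in>Basis. ?D a b *\<^sub>R b)"
    using D' unfolding has_C1_gradient_def gderiv_def by blast
qed

text \<open>The product rule for the sum over \<open>k\<close> of
  \<open>x $ i k * (a k * z k x)\<close>, plus \<open>x $ j\<close>: \<open>i k\<close> is a weight
  coordinate, \<open>j\<close> the bias coordinate, \<open>a k\<close> the slope of the activation,
  and \<open>z\<close>, \<open>G\<close> are the values and gradients of the inputs at
  \<open>x\<close>.\<close>

definition layer_gradient ::
  "'k set \<Rightarrow> ('k \<Rightarrow> 'n) \<Rightarrow> 'n \<Rightarrow> ('k \<Rightarrow> real) \<Rightarrow> ('k \<Rightarrow> real) \<Rightarrow> ('k \<Rightarrow> real ^ 'n) \<Rightarrow> real ^ 'n \<Rightarrow> real ^ 'n"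
  where "layer_gradient S i j a z G x =
    (\<Sum>k\<in>S. x $ i k *\<^sub>R (a k *\<^sub>R G k) + (a k * z k) *\<^sub>R axis (i k) 1) + axis j 1"

lemma has_C1_gradient_layer:
  assumes "\<And>k. k \<in> S \<Longrightarrow> has_C1_gradient (z k) (G k)"
  shows "has_C1_gradient (\<lambda>x. (\<Sum>k\<in>S. x $ i k * (a k * z k x)) + x $ j)
    (\<lambda>x. layer_gradient S i j a (\<lambda>k. z k x) (\<lambda>k. G k x) x)"
proof -
  have "has_C1_gradient (\<lambda>x. a k * z k x) (\<lambda>x. a k *\<^sub>R G k x)" if "k \<in> S" for k
    using has_C1_gradient_mult[OF has_C1_gradient_const[of "a k"] assms[OF that]] by simp
  then show ?thesis
    unfolding layer_gradient_def
    by (intro has_C1_gradient_add[OF has_C1_gradient_sum has_C1_gradient_nth]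
        has_C1_gradient_mult[OF has_C1_gradient_nth])
qed

lemma layer_gradient_cong:
  assumes "\<And>k. k \<in> S \<Longrightarrow> a k *\<^sub>R G k = a' k *\<^sub>R G' k"
    and "\<And>k. k \<in> S \<Longrightarrow> a k * z k = a' k * z' k"
  shows "layer_gradient S i j a z G x = layer_gradient S i j a' z' G' x"
  using assms by (simp add: layer_gradient_def)

text \<open>The terms coming from weights and bias are common to all three gradients;
  \<open>p + q = 1\<close> reproduces them, and the remaining terms are linear in
  \<open>a k *\<^sub>R G k\<close>.\<close>

lemma layer_gradient_affine_combination:
  assumes "p + q = 1"
    and "\<And>k. k \<in> S \<Longrightarrow> a k *\<^sub>R G k = p *\<^sub>R (a0 k *\<^sub>R G0 k) + q *\<^sub>R (a1 k *\<^sub>R G1 k)"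
    and "\<And>k. k \<in> S \<Longrightarrow> a0 k * z0 k = a k * z k" and "\<And>k. k \<in> S \<Longrightarrow> a1 k * z1 k = a k * z k"
  shows "layer_gradient S i j a z G x =
    p *\<^sub>R layer_gradient S i j a0 z0 G0 x + q *\<^sub>R layer_gradient S i j a1 z1 G1 x"
proof -
  have pq: "p *\<^sub>R w + q *\<^sub>R w = w" for w :: "real ^ 'b"
    using assms(1) by (metis scaleR_left_distrib scaleR_one)
  have "x $ i k *\<^sub>R (a k *\<^sub>R G k) + (a k * z k) *\<^sub>R axis (i k) 1 =
      p *\<^sub>R (x $ i k *\<^sub>R (a0 k *\<^sub>R G0 k) + (a0 k * z0 k) *\<^sub>R axis (i k) 1) +
      q *\<^sub>R (x $ i k *\<^sub>R (a1 k *\<^sub>R G1 k) + (a1 k * z1 k) *\<^sub>R axis (i k) 1)" (is "_ = ?r")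
    if "k \<in> S" for k
  proof -
    have "?r = x $ i k *\<^sub>R (p *\<^sub>R (a0 k *\<^sub>R G0 k) + q *\<^sub>R (a1 k *\<^sub>R G1 k)) +
        (p *\<^sub>R ((a k * z k) *\<^sub>R axis (i k) 1) + q *\<^sub>R ((a k * z k) *\<^sub>R axis (i k) 1))"
      using assms(3,4)[OF that] by (simp only:) (simp add: algebra_simps)
    then show ?thesis
      using assms(2)[OF that] by (simp only: pq)
  qed
  then have "layer_gradient S i j a z G x =
      p *\<^sub>R (\<Sum>k\<in>S. x $ i k *\<^sub>R (a0 k *\<^sub>R G0 k) + (a0 k * z0 k) *\<^sub>R axis (i k) 1) +
      q *\<^sub>R (\<Sum>k\<in>S. x $ i k *\<^sub>R (a1 k *\<^sub>R G1 k) + (a1 k * z1 k) *\<^sub>R axis (i k) 1) +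
      (p *\<^sub>R axis j 1 + q *\<^sub>R axis j 1)"
    unfolding layer_gradient_def pq scaleR_sum_right sum.distrib [symmetric]
    by (simp only: cong: sum.cong)
  then show ?thesis
    unfolding layer_gradient_def by (simp only: scaleR_right_distrib add_ac)
qed

section \<open>Switching vectors and LIKQ\<close>

lemma diag_mult_nth: "(diag d *v z) $ i = d $ i * z $ i"
proof -
  have "(diag d *v z) $ i = (\<Sum>j\<in>UNIV. if i = j then d $ i * z $ j else 0)"
    unfolding matrix_vector_mult_def diag_def vec_lambda_beta by (intro sum.cong) simp_all
  then show ?thesis
    by simp
qed

lemma abs_vec_nth: "\<bar>z :: real ^ 'h\<bar> $ i = \<bar>z $ i\<bar>"
  by (simp add: abs_vec_def)

locale relu_network =
  fixes T :: nat and layer :: "'h::finite \<Rightarrow> nat"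
    and idx :: "('i::finite, 'h, 'm::finite) neuron parameter \<Rightarrow> 'n::finite"
    and u :: "real ^ 'i"
  assumes layer: "layer k \<in> {1..T}"
    and bij_idx: "bij_betw idx (parameters T layer) UNIV"
begin

abbreviation c :: "real ^ 'n \<Rightarrow> real ^ 'h \<Rightarrow> real ^ 'h \<Rightarrow> real ^ 'h" where
  "c \<equiv> net_c layer idx u"

lemma c_nth:
  "c x y z $ k =
    (if layer k = 1 then \<Sum>i\<in>UNIV. x $ idx (Weight (Hid k) (In i)) * u $ i
     else 1/2 * (\<Sum>l | layer l = layer k - 1. x $ idx (Weight (Hid k) (Hid l)) * (z $ l + y $ l)))
    + x $ idx (Bias (Hid k))"
  by (simp add: net_c_def weight_def bias_def)

text \<open>Layers start at 1, so the truncated subtraction really decreases.\<close>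

lemma pred_layer_less: "layer l = layer k - 1 \<Longrightarrow> layer l < layer k"
  using layer[of k] by simp

lemma c_triangular:
  assumes "\<And>l. layer l < layer k \<Longrightarrow> z $ l = z' $ l"
    and "\<And>l. layer l < layer k \<Longrightarrow> y $ l = y' $ l"
  shows "c x y z $ k = c x y' z' $ k"
  using assms pred_layer_less by (auto simp: c_nth intro!: sum.cong)

lemma switching_unique: "\<exists>!z. z = c x \<bar>z\<bar> z"
  by (intro triangular_fixpoint[of layer] c_triangular) (auto simp: abs_vec_nth)

lemma smooth_switching_unique: "\<exists>!z. z = c x (diag \<xi> *v z) z"
  by (intro triangular_fixpoint[of layer] c_triangular) (auto simp: diag_mult_nth)

lemma switching_fixpoint: "switching c x = c x \<bar>switching c x\<bar> (switching c x)"
  using theI'[OF switching_unique] unfolding switching_def .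

lemma switching_eqI: "z = c x \<bar>z\<bar> z \<Longrightarrow> switching c x = z"
  using switching_unique switching_fixpoint by blast

lemma smooth_switching_fixpoint:
  "smooth_switching c \<xi> x = c x (diag \<xi> *v smooth_switching c \<xi> x) (smooth_switching c \<xi> x)"
  using theI'[OF smooth_switching_unique] unfolding smooth_switching_def .

lemma smooth_switching_eqI: "z = c x (diag \<xi> *v z) z \<Longrightarrow> smooth_switching c \<xi> x = z"
  using smooth_switching_unique smooth_switching_fixpoint by blast

lemma linear_c: "linear (\<lambda>x. c x y z)"
  by (rule linearI)
    (auto simp: vec_eq_iff c_nth algebra_simps sum.distrib sum_distrib_left)

text \<open>Embeds the space of pre-activations into the parameter space as the hidden bias
  coordinates. It serves as right inverse of the parameter Jacobian and as the means of prescribing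
  pre-activations.\<close>

definition bias_shift :: "real ^ 'h \<Rightarrow> real ^ 'n" where
  "bias_shift d =
    (\<chi> n. case inv_into (parameters T layer) idx n of Bias (Hid k) \<Rightarrow> d $ k | _ \<Rightarrow> 0)"

lemma linear_bias_shift: "linear bias_shift"
  by (rule linearI)
    (auto simp: vec_eq_iff bias_shift_def split: parameter.split neuron.split)

lemma bias_shift_nth:
  assumes "q \<in> parameters T layer"
  shows "bias_shift d $ idx q = (case q of Bias (Hid k) \<Rightarrow> d $ k | _ \<Rightarrow> 0)"
  using assms bij_idx by (simp add: bias_shift_def bij_betw_def)

text \<open>All weights entering \<open>c\<close> vanish at such a parameter vector, so
  \<open>y\<close>, \<open>z\<close> and the sample drop out.\<close>

lemma c_bias_shift: "c (bias_shift d) y z = d"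
proof -
  have "bias_shift d $ idx (Weight (Hid k) (In i)) = 0" if "layer k = 1" for k i
    using that by (subst bias_shift_nth) (simp_all add: parameters_def)
  moreover have "bias_shift d $ idx (Weight (Hid k) (Hid l)) = 0" if "layer l = layer k - 1" for k l
    using that layer[of k] by (subst bias_shift_nth) (simp_all add: parameters_def)
  moreover have "bias_shift d $ idx (Bias (Hid k)) = d $ k" for k
    using layer[of k] by (subst bias_shift_nth) (simp_all add: parameters_def)
  ultimately have "c (bias_shift d) y z $ k = d $ k" for k
    by (cases "layer k = 1") (simp_all add: c_nth)
  then show ?thesis
    by (simp add: vec_eq_iff)
qed

text \<open>As \<open>c\<close> depends on \<open>y\<close> and \<open>z\<close> only through their
  sum, this single linear part gives both Jacobians L and M.\<close>

definition hidden_map :: "real ^ 'n \<Rightarrow> real ^ 'h \<Rightarrow> real ^ 'h" where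
  "hidden_map x d = (\<chi> k. if layer k = 1 then 0
     else 1/2 * (\<Sum>l | layer l = layer k - 1. x $ idx (Weight (Hid k) (Hid l)) * d $ l))"

lemma linear_hidden_map: "linear (hidden_map x)"
  by (rule linearI)
    (auto simp: vec_eq_iff hidden_map_def algebra_simps sum.distrib sum_distrib_left)

lemma c_add_y: "c x (y + d) z = c x y z + hidden_map x d"
  and c_add_z: "c x y (z + d) = c x y z + hidden_map x d"
  by (auto simp: vec_eq_iff c_nth hidden_map_def algebra_simps sum.distrib)

lemma hidden_map_triangular:
  assumes "\<And>l. layer l < layer k \<Longrightarrow> d $ l = d' $ l"
  shows "hidden_map x d $ k = hidden_map x d' $ k"
  using assms pred_layer_less by (auto simp: hidden_map_def intro!: sum.cong)

lemma LIKQ_net_c: "LIKQ c x"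
proof -
  define z where "z = switching c x"
  define \<alpha> where "\<alpha> = {i. signature z $ i = 0}"
  define A where "A = matrix (hidden_map x)"
  define Z where "Z = jacobian (\<lambda>x'. c x' \<bar>z\<bar> z) (at x)"
  define S where "S = mat 1 - A ** diag (signature z) - A"
  have Lj: "jacobian (\<lambda>y. c x y z) (at \<bar>z\<bar>) = A"
    using frechet_derivative_affine[OF linear_hidden_map, of "\<lambda>y. c x y z"]
    by (simp add: jacobian_def A_def c_add_y)
  have Mj: "jacobian (\<lambda>z'. c x \<bar>z\<bar> z') (at z) = A"
    using frechet_derivative_affine[OF linear_hidden_map, of "\<lambda>z'. c x \<bar>z\<bar> z'"]
    by (simp add: jacobian_def A_def c_add_z)
  have Zj: "Z = matrix (\<lambda>x'. c x' \<bar>z\<bar> z)"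
    using frechet_derivative_affine[OF linear_c, of "\<lambda>x'. c x' \<bar>z\<bar> z"] linear_add[OF linear_c]
    by (simp add: jacobian_def Z_def)
  have ZB: "Z ** matrix bias_shift = mat 1"
    unfolding matrix_eq
    by (simp add: Zj matrix_vector_mul_assoc [symmetric] matrix_works linear_c linear_bias_shift
        c_bias_shift)
  \<comment> \<open>A kernel vector of \<open>S\<close> is a fixed point of a triangular map that
    also fixes 0; uniqueness of the fixed point replaces a determinant computation.\<close>
  have "w = 0" if w: "S *v w = 0" for w
  proof -
    let ?F = "\<lambda>w. hidden_map x (diag (signature z) *v w) + hidden_map x w"
    have "\<exists>!w. w = ?F w"
      by (rule triangular_fixpoint[of layer])
        (auto simp: diag_mult_nth intro!: arg_cong2[where f="(+)"] hidden_map_triangular)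
    moreover have "w = ?F w"
      using w by (simp add: S_def A_def matrix_vector_mult_diff_rdistrib
          matrix_vector_mul_assoc [symmetric] matrix_works linear_hidden_map algebra_simps)
    moreover have "0 = ?F 0"
      by (simp add: linear_0[OF linear_hidden_map])
    ultimately show ?thesis
      by metis
  qed
  then have "invertible S"
    by (metis invertible_left_inverse matrix_left_invertible_ker)
  then have "matrix_inv S ** S = mat 1"
    unfolding invertible_def matrix_inv_def by (metis (mono_tags, lifting) someI_ex)
  \<comment> \<open>The factor to the right of \<open>row_selection\<close> is right invertible, so
    it does not change the rank.\<close>
  then have "(matrix_inv S ** Z) ** (matrix bias_shift ** S) = mat 1"
    by (metis ZB matrix_mul_assoc matrix_mul_lid)
  then have "rank (row_selection \<alpha> ** matrix_inv S ** Z) = card \<alpha>"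
    by (metis rank_mult_right_invertible rank_row_selection matrix_mul_assoc)
  then show ?thesis
    unfolding LIKQ_def Let_def z_def [symmetric] \<alpha>_def [symmetric] Lj Mj Z_def [symmetric]
      S_def [symmetric] by simp
qed

section \<open>Gradients of the smooth models\<close>

text \<open>Replacing the absolute value of \<open>z $ l\<close> by \<open>\<xi> $ l * z $ l\<close>
  turns relu into a linear activation of slope \<open>(1 + \<xi> $ l) / 2\<close>.\<close>

lemma half_sum_diag:
  "1/2 * (\<Sum>l\<in>S. w l * (z $ l + (diag \<xi> *v z) $ l)) = (\<Sum>l\<in>S. w l * ((1 + \<xi> $ l) / 2 * z $ l))"
  unfolding sum_distrib_left diag_mult_nth by (intro sum.cong refl) (simp add: field_simps)

text \<open>The factor 1 on the inputs gives the first layer the shape required by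
  \<open>has_C1_gradient_layer\<close>, too.\<close>

lemma smooth_switching_nth:
  "smooth_switching c \<xi> x $ k =
    (if layer k = 1 then \<Sum>i\<in>UNIV. x $ idx (Weight (Hid k) (In i)) * (1 * u $ i)
     else \<Sum>l | layer l = layer k - 1.
       x $ idx (Weight (Hid k) (Hid l)) * ((1 + \<xi> $ l) / 2 * smooth_switching c \<xi> x $ l))
    + x $ idx (Bias (Hid k))"
proof -
  have "smooth_switching c \<xi> x $ k =
      c x (diag \<xi> *v smooth_switching c \<xi> x) (smooth_switching c \<xi> x) $ k"
    using smooth_switching_fixpoint[of \<xi> x] by simp
  then show ?thesis
    unfolding c_nth half_sum_diag mult_1 .
qed

text \<open>Chosen first; its recursion over the layers then follows from uniqueness of
  gradients.\<close>

definition smooth_switching_gradient :: "real ^ 'h \<Rightarrow> 'h \<Rightarrow> real ^ 'n \<Rightarrow> real ^ 'n" where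
  "smooth_switching_gradient \<xi> k = (SOME g. has_C1_gradient (\<lambda>x. smooth_switching c \<xi> x $ k) g)"

definition hidden_gradient ::
  "real ^ 'h \<Rightarrow> ('h \<Rightarrow> real) \<Rightarrow> ('h \<Rightarrow> real ^ 'n) \<Rightarrow> 'h \<Rightarrow> real ^ 'n \<Rightarrow> real ^ 'n" where
  "hidden_gradient \<xi> z G k x =
    (if layer k = 1
     then layer_gradient UNIV (\<lambda>i. idx (Weight (Hid k) (In i))) (idx (Bias (Hid k)))
       (\<lambda>i. 1) (\<lambda>i. u $ i) (\<lambda>i. 0) x
     else layer_gradient {l. layer l = layer k - 1} (\<lambda>l. idx (Weight (Hid k) (Hid l)))
       (idx (Bias (Hid k))) (\<lambda>l. (1 + \<xi> $ l) / 2) z G x)"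

lemma has_C1_gradient_smooth_switching_step:
  assumes "\<And>l. layer l < layer k \<Longrightarrow> has_C1_gradient (\<lambda>x. smooth_switching c \<xi> x $ l) (G l)"
  shows "has_C1_gradient (\<lambda>x. smooth_switching c \<xi> x $ k)
    (\<lambda>x. hidden_gradient \<xi> (\<lambda>l. smooth_switching c \<xi> x $ l) (\<lambda>l. G l x) k x)"
proof (cases "layer k = 1")
  case True
  then show ?thesis
    unfolding smooth_switching_nth[of _ _ k] hidden_gradient_def if_P[OF True]
    by (intro has_C1_gradient_layer has_C1_gradient_const)
next
  case False
  then show ?thesis
    unfolding smooth_switching_nth[of _ _ k] hidden_gradient_def if_not_P[OF False]
    using pred_layer_less by (intro has_C1_gradient_layer assms) simp
qed

text \<open>The defining equation is triangular, so induction over the layers takes the place of the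
  implicit function theorem.\<close>

lemma has_C1_gradient_smooth_switching:
  "has_C1_gradient (\<lambda>x. smooth_switching c \<xi> x $ k) (smooth_switching_gradient \<xi> k)"
proof (induction "layer k" arbitrary: k rule: less_induct)
  case less
  have "has_C1_gradient (\<lambda>x. smooth_switching c \<xi> x $ k) (\<lambda>x. hidden_gradient \<xi>
      (\<lambda>l. smooth_switching c \<xi> x $ l) (\<lambda>l. smooth_switching_gradient \<xi> l x) k x)"
    using less by (rule has_C1_gradient_smooth_switching_step)
  then show ?case
    unfolding smooth_switching_gradient_def[of \<xi> k]
    by (rule someI[where P = "has_C1_gradient (\<lambda>x. smooth_switching c \<xi> x $ k)"])
qed

lemma smooth_switching_gradient_rec:
  "smooth_switching_gradient \<xi> k x = hidden_gradient \<xi> (\<lambda>l. smooth_switching c \<xi> x $ l)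
    (\<lambda>l. smooth_switching_gradient \<xi> l x) k x"
  by (rule has_C1_gradient_unique[OF has_C1_gradient_smooth_switching
        has_C1_gradient_smooth_switching_step[OF has_C1_gradient_smooth_switching]])

definition smooth_output :: "real ^ 'h \<Rightarrow> real ^ 'n \<Rightarrow> real ^ 'm" where
  "smooth_output \<xi> x = (\<chi> m. (\<Sum>k | layer k = T.
      x $ idx (Weight (Out m) (Hid k)) * ((1 + \<xi> $ k) / 2 * smooth_switching c \<xi> x $ k))
    + x $ idx (Bias (Out m)))"

definition smooth_output_gradient :: "real ^ 'h \<Rightarrow> 'm \<Rightarrow> real ^ 'n \<Rightarrow> real ^ 'n" where
  "smooth_output_gradient \<xi> m x = layer_gradient {k. layer k = T}
    (\<lambda>k. idx (Weight (Out m) (Hid k))) (idx (Bias (Out m))) (\<lambda>k. (1 + \<xi> $ k) / 2)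
    (\<lambda>k. smooth_switching c \<xi> x $ k) (\<lambda>k. smooth_switching_gradient \<xi> k x) x"

definition smooth_model_gradient :: "(real ^ 'm \<Rightarrow> real ^ 'm) \<Rightarrow> real ^ 'h \<Rightarrow> real ^ 'n \<Rightarrow> real ^ 'n" where
  "smooth_model_gradient F' \<xi> x =
    (\<Sum>m\<in>UNIV. F' (smooth_output \<xi> x) $ m *\<^sub>R smooth_output_gradient \<xi> m x)"

lemma smooth_model_eq:
  "smooth_model (net_f T layer idx h loss v) c \<xi> = (\<lambda>x. loss (h (smooth_output \<xi> x)) v)"
  unfolding smooth_model_def net_f_def smooth_output_def weight_def bias_def half_sum_diag Let_def ..

lemma has_C1_gradient_smooth_model:
  assumes "has_C1_gradient F F'"
  shows "has_C1_gradient (\<lambda>x. F (smooth_output \<xi> x)) (smooth_model_gradient F' \<xi>)"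
proof -
  have "has_C1_gradient (\<lambda>x. smooth_output \<xi> x $ m) (smooth_output_gradient \<xi> m)" for m
    unfolding smooth_output_def smooth_output_gradient_def vec_lambda_beta
    by (intro has_C1_gradient_layer has_C1_gradient_smooth_switching)
  then show ?thesis
    unfolding smooth_model_gradient_def by (rule has_C1_gradient_compose[OF assms])
qed

text \<open>Stated with products, the admissibility of \<open>\<xi>\<close> leaves the kink components free and says exactly
  that \<open>diag \<xi> *v z\<close> is \<open>\<bar>z\<bar>\<close>.\<close>

definition aligned :: "real ^ 'h \<Rightarrow> real ^ 'n \<Rightarrow> bool" where
  "aligned \<xi> x \<longleftrightarrow> (\<forall>k. \<xi> $ k * switching c x $ k = \<bar>switching c x $ k\<bar>)"

text \<open>Under alignment the switching vector also solves the equation of the smooth model. Hence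
  the pre-activations at \<open>x\<close> are the same for all aligned \<xi>.\<close>

lemma aligned_smooth_switching: "aligned \<xi> x \<Longrightarrow> smooth_switching c \<xi> x = switching c x"
proof (rule smooth_switching_eqI)
  assume "aligned \<xi> x"
  then have "diag \<xi> *v switching c x = \<bar>switching c x\<bar>"
    by (simp add: aligned_def vec_eq_iff diag_mult_nth abs_vec_nth)
  then show "switching c x = c x (diag \<xi> *v switching c x) (switching c x)"
    using switching_fixpoint by simp
qed

text \<open>Allows alignment to be tested on the solution of the smooth model, whose signs are the
  ones controlled near \<open>x\<close>.\<close>

lemma alignedI:
  assumes "\<And>k. \<xi> $ k * smooth_switching c \<xi> x $ k = \<bar>smooth_switching c \<xi> x $ k\<bar>"
  shows "aligned \<xi> x"
proof -
  have "diag \<xi> *v smooth_switching c \<xi> x = \<bar>smooth_switching c \<xi> x\<bar>"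
    using assms by (simp add: vec_eq_iff diag_mult_nth abs_vec_nth)
  then have "switching c x = smooth_switching c \<xi> x"
    using smooth_switching_fixpoint[of \<xi> x] by (intro switching_eqI) simp
  then show ?thesis
    using assms by (simp add: aligned_def)
qed

section \<open>The forward pass of the network and its agreement with aligned smooth models\<close>

lemma sum_level_0:
  fixes f :: "('i, 'h, 'm) neuron \<Rightarrow> real"
  shows "(\<Sum>q | level T layer q = 0. f q) = (\<Sum>i\<in>UNIV. f (In i))"
proof -
  have "level T layer q = 0 \<longleftrightarrow> (\<exists>i. q = In i)" for q :: "('i, 'h, 'm) neuron"
    using layer by (cases q) (auto simp: Suc_le_eq dest: less_not_refl2)
  then have "{q :: ('i, 'h, 'm) neuron. level T layer q = 0} = range In"
    by auto
  then show ?thesis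
    by (simp add: sum.reindex inj_on_def)
qed

lemma sum_level_hidden:
  fixes f :: "('i, 'h, 'm) neuron \<Rightarrow> real"
  assumes "1 \<le> t" and "t \<le> T"
  shows "(\<Sum>q | level T layer q = t. f q) = (\<Sum>k | layer k = t. f (Hid k))"
proof -
  have "level T layer q = t \<longleftrightarrow> (\<exists>k. q = Hid k \<and> layer k = t)" for q :: "('i, 'h, 'm) neuron"
    using assms by (cases q) auto
  then have "{q :: ('i, 'h, 'm) neuron. level T layer q = t} = Hid ` {k. layer k = t}"
    by auto
  then show ?thesis
    by (simp add: sum.reindex inj_on_def)
qed

lemma activation_hidden:
  "activation T layer idx x u (layer k) (Hid k) = relu (switching c x $ k)"
proof (induction "layer k" arbitrary: k rule: less_induct)
  case less
  define t where "t = layer k - 1"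
  have t: "layer k = Suc t"
    using layer[of k] by (simp add: t_def)
  have z: "switching c x $ k = c x \<bar>switching c x\<bar> (switching c x) $ k"
    using switching_fixpoint[of x] by simp
  have "(\<Sum>q | level T layer q = t. weight idx x (Hid k) q * activation T layer idx x u t q)
      + bias idx x (Hid k) = switching c x $ k"
  \<comment> \<open>Inputs enter the first layer without relu; in later layers the factor 1/2 in
    \<open>c\<close> turns \<open>z + \<bar>z\<bar>\<close> into relu.\<close>
  proof (cases "t = 0")
    case True
    then show ?thesis
      unfolding z c_nth by (simp add: t sum_level_0 weight_def bias_def)
  next
    case False
    have "(\<Sum>q | level T layer q = t. weight idx x (Hid k) q * activation T layer idx x u t q)
      = (\<Sum>l | layer l = t. weight idx x (Hid k) (Hid l) * activation T layer idx x u t (Hid l))"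
      using False layer[of k] t by (intro sum_level_hidden) auto
    also have "\<dots> = (\<Sum>l | layer l = t. weight idx x (Hid k) (Hid l) * relu (switching c x $ l))"
      using less t by (intro sum.cong) auto
    finally show ?thesis
      using False unfolding z c_nth
      by (simp add: t weight_def bias_def relu_def abs_vec_nth sum_divide_distrib)
  qed
  then show ?case
    by (simp add: t)
qed

lemma aligned_net:
  assumes "aligned \<xi> x"
  shows "net T layer idx h u x = h (smooth_output \<xi> x)"
proof -
  have relu: "relu (switching c x $ k) = (1 + \<xi> $ k) / 2 * switching c x $ k" for k
    using assms by (simp add: aligned_def relu_def algebra_simps)
  have "(\<Sum>q | level T layer q = T. weight idx x (Out m) q * activation T layer idx x u T q)
      = (\<Sum>k | layer k = T. weight idx x (Out m) (Hid k) * relu (switching c x $ k))" for m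
  proof -
    \<comment> \<open>The type of hidden neurons is inhabited and their layers lie in
      \<open>{1..T}\<close>; so level \<open>T\<close> consists of hidden neurons, not
      inputs.\<close>
    have "1 \<le> T"
      using layer[of undefined] by simp
    then have "(\<Sum>q | level T layer q = T. weight idx x (Out m) q * activation T layer idx x u T q)
      = (\<Sum>k | layer k = T. weight idx x (Out m) (Hid k) * activation T layer idx x u T (Hid k))"
      by (intro sum_level_hidden) auto
    also have "\<dots> = (\<Sum>k | layer k = T. weight idx x (Out m) (Hid k) * relu (switching c x $ k))"
      using activation_hidden by (intro sum.cong) auto
    finally show ?thesis .
  qed
  then show ?thesis
    unfolding net_def smooth_output_def aligned_smooth_switching[OF assms]
    by (simp add: relu weight_def bias_def)
qed

text \<open>A neuron in the layer of \<open>j\<close> or below receives no input from \<open>j\<close>; this excludes terms quadratic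
  in \<open>\<xi> $ j\<close> from the recursion of the gradients.\<close>

lemma smooth_switching_gradient_eq:
  assumes "aligned \<xi> x" and "aligned \<xi>' x" and "\<And>l. l \<noteq> j \<Longrightarrow> \<xi> $ l = \<xi>' $ l"
    and "layer k \<le> layer j"
  shows "smooth_switching_gradient \<xi> k x = smooth_switching_gradient \<xi>' k x"
  using assms(4)
proof (induction "layer k" arbitrary: k rule: less_induct)
  case less
  have eq: "\<xi> $ l = \<xi>' $ l \<and> smooth_switching_gradient \<xi> l x = smooth_switching_gradient \<xi>' l x"
    if "layer l = layer k - 1" for l
    using less assms(3)[of l] pred_layer_less[OF that] by fastforce
  then show ?case
    unfolding smooth_switching_gradient_rec[of _ k] hidden_gradient_def
      aligned_smooth_switching[OF assms(1)] aligned_smooth_switching[OF assms(2)]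
    by (intro if_cong layer_gradient_cong) auto
qed

section \<open>Affine dependence of the gradients on a single kink coordinate\<close>

context
  fixes x :: "real ^ 'n" and \<xi> \<xi>0 \<xi>1 :: "real ^ 'h" and j :: 'h and p q :: real
  assumes al: "aligned \<xi> x" "aligned \<xi>0 x" "aligned \<xi>1 x"
    and off: "\<And>l. l \<noteq> j \<Longrightarrow> \<xi>0 $ l = \<xi> $ l" "\<And>l. l \<noteq> j \<Longrightarrow> \<xi>1 $ l = \<xi> $ l"
    and kink: "switching c x $ j = 0" and pq: "p + q = 1"
    and on: "\<xi> $ j = p * \<xi>0 $ j + q * \<xi>1 $ j"
begin

text \<open>For each input either the slope or the gradient is common to \<xi>, \<xi>0 and \<xi>1:
  at \<open>j\<close> the gradient, elsewhere the slope. So their product stays affine; the weight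
  terms agree because the pre-activation at \<open>j\<close> is 0.\<close>

lemma layer_gradient_kink_combination:
  assumes G: "\<And>l. l \<in> S \<Longrightarrow> smooth_switching_gradient \<xi> l x =
    p *\<^sub>R smooth_switching_gradient \<xi>0 l x + q *\<^sub>R smooth_switching_gradient \<xi>1 l x"
  shows "layer_gradient S i b (\<lambda>l. (1 + \<xi> $ l) / 2) (\<lambda>l. switching c x $ l)
      (\<lambda>l. smooth_switching_gradient \<xi> l x) x =
    p *\<^sub>R layer_gradient S i b (\<lambda>l. (1 + \<xi>0 $ l) / 2) (\<lambda>l. switching c x $ l)
      (\<lambda>l. smooth_switching_gradient \<xi>0 l x) x +
    q *\<^sub>R layer_gradient S i b (\<lambda>l. (1 + \<xi>1 $ l) / 2) (\<lambda>l. switching c x $ l)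
      (\<lambda>l. smooth_switching_gradient \<xi>1 l x) x"
proof (rule layer_gradient_affine_combination[OF pq])
  fix l assume l: "l \<in> S"
  show "(1 + \<xi>0 $ l) / 2 * switching c x $ l = (1 + \<xi> $ l) / 2 * switching c x $ l"
    using off(1)[of l] kink by (cases "l = j") auto
  show "(1 + \<xi>1 $ l) / 2 * switching c x $ l = (1 + \<xi> $ l) / 2 * switching c x $ l"
    using off(2)[of l] kink by (cases "l = j") auto
  show "((1 + \<xi> $ l) / 2) *\<^sub>R smooth_switching_gradient \<xi> l x =
    p *\<^sub>R (((1 + \<xi>0 $ l) / 2) *\<^sub>R smooth_switching_gradient \<xi>0 l x) +
    q *\<^sub>R (((1 + \<xi>1 $ l) / 2) *\<^sub>R smooth_switching_gradient \<xi>1 l x)"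
  proof (cases "l = j")
    case True
    have "smooth_switching_gradient \<xi>0 j x = smooth_switching_gradient \<xi> j x"
      "smooth_switching_gradient \<xi>1 j x = smooth_switching_gradient \<xi> j x"
      using off al by (auto intro: smooth_switching_gradient_eq[of _ _ _ j])
    moreover have "(1 + \<xi> $ j) / 2 = p * ((1 + \<xi>0 $ j) / 2) + q * ((1 + \<xi>1 $ j) / 2)"
    proof -
      have q: "q = 1 - p"
        using pq by simp
      show ?thesis
        unfolding on q by (simp add: field_simps)
    qed
    ultimately show ?thesis
      unfolding True by (simp only: scaleR_left_distrib scaleR_scaleR)
  next
    case False
    then show ?thesis
      using off[OF False] by (simp only: G[OF l] scaleR_right_distrib scaleR_left_commute)
  qed
qed

lemma smooth_switching_gradient_combination:
  "smooth_switching_gradient \<xi> k x =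
    p *\<^sub>R smooth_switching_gradient \<xi>0 k x + q *\<^sub>R smooth_switching_gradient \<xi>1 k x"
proof (induction "layer k" arbitrary: k rule: less_induct)
  case less
  show ?case
  proof (cases "layer k = 1")
    case True
    then show ?thesis
      \<comment> \<open>In the first layer the gradient does not involve \<xi>, and
        \<open>p + q = 1\<close> suffices.\<close>
      unfolding smooth_switching_gradient_rec[of _ k] hidden_gradient_def if_P[OF True]
      by (simp only: scaleR_left_distrib [symmetric] pq scaleR_one)
  next
    case False
    show ?thesis
      unfolding smooth_switching_gradient_rec[of _ k] hidden_gradient_def if_not_P[OF False]
        al[THEN aligned_smooth_switching]
      by (intro layer_gradient_kink_combination less pred_layer_less) simp
  qed
qed

lemma smooth_model_gradient_combination:
  "smooth_model_gradient F' \<xi> x =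
    p *\<^sub>R smooth_model_gradient F' \<xi>0 x + q *\<^sub>R smooth_model_gradient F' \<xi>1 x"
proof -
  have "smooth_output_gradient \<xi> m x =
      p *\<^sub>R smooth_output_gradient \<xi>0 m x + q *\<^sub>R smooth_output_gradient \<xi>1 m x" for m
    unfolding smooth_output_gradient_def al[THEN aligned_smooth_switching]
    by (intro layer_gradient_kink_combination smooth_switching_gradient_combination)
  \<comment> \<open>Taking \<open>h\<close> to be the identity in \<open>aligned_net\<close>
    identifies all three outputs, so \<open>F'\<close> is evaluated at one common point.\<close>
  moreover have "smooth_output \<xi>0 x = smooth_output \<xi> x" "smooth_output \<xi>1 x = smooth_output \<xi> x"
    using aligned_net[OF al(1), of id] aligned_net[OF al(2), of id] aligned_net[OF al(3), of id] by auto
  ultimately show ?thesis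
    by (simp only: smooth_model_gradient_def scaleR_sum_right scaleR_right_distrib sum.distrib
        scaleR_left_commute)
qed

end

text \<open>Induction on the number of coordinates of \<xi> strictly inside the interval: one of
  them is moved to both endpoints, and the gradient is a convex combination of the two
  results.\<close>

lemma smooth_model_gradient_in_convex:
  assumes C: "convex C"
    and vertex: "\<And>\<sigma>. (\<forall>k. \<bar>\<sigma> $ k\<bar> = 1) \<Longrightarrow> aligned \<sigma> x \<Longrightarrow> smooth_model_gradient F' \<sigma> x \<in> C"
    and "\<forall>k. \<bar>\<xi> $ k\<bar> \<le> 1" and "aligned \<xi> x"
  shows "smooth_model_gradient F' \<xi> x \<in> C"
  using assms(3,4)
proof (induction "card {k. \<bar>\<xi> $ k\<bar> \<noteq> 1}" arbitrary: \<xi> rule: less_induct)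
  case less
  show ?case
  proof (cases "\<forall>k. \<bar>\<xi> $ k\<bar> = 1")
    case True
    then show ?thesis
      using vertex less.prems by blast
  next
    case False
    then obtain j where j: "\<bar>\<xi> $ j\<bar> \<noteq> 1"
      by blast
    \<comment> \<open>Off the kinks, alignment forces absolute value 1.\<close>
    have kink: "switching c x $ j = 0"
    proof (rule ccontr)
      assume "switching c x $ j \<noteq> 0"
      moreover have "\<bar>\<xi> $ j\<bar> * \<bar>switching c x $ j\<bar> = \<bar>switching c x $ j\<bar>"
        using less.prems(2) by (metis aligned_def abs_mult abs_abs)
      ultimately show False
        using j by simp
    qed
    define \<eta> where "\<eta> s = (\<chi> l. if l = j then s else \<xi> $ l)" for s
    have al: "aligned (\<eta> s) x" for s
      using less.prems(2) kink by (auto simp: aligned_def \<eta>_def)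
    have mem: "smooth_model_gradient F' (\<eta> s) x \<in> C" if s: "\<bar>s\<bar> = 1" for s
    proof (rule less.hyps)
      show "card {k. \<bar>\<eta> s $ k\<bar> \<noteq> 1} < card {k. \<bar>\<xi> $ k\<bar> \<noteq> 1}"
        using j s by (intro psubset_card_mono) (auto simp: \<eta>_def)
      show "\<forall>k. \<bar>\<eta> s $ k\<bar> \<le> 1"
        using less.prems(1) s by (simp add: \<eta>_def)
      show "aligned (\<eta> s) x"
        by (rule al)
    qed
    \<comment> \<open>The weights write \<open>\<xi> $ j\<close> as a convex combination of -1 and
      1.\<close>
    have "smooth_model_gradient F' \<xi> x =
      ((1 - \<xi> $ j) / 2) *\<^sub>R smooth_model_gradient F' (\<eta> (- 1)) x +
      ((1 + \<xi> $ j) / 2) *\<^sub>R smooth_model_gradient F' (\<eta> 1) x"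
      by (rule smooth_model_gradient_combination[OF less.prems(2) al al _ _ kink])
        (simp_all add: \<eta>_def field_simps)
    moreover have "0 \<le> 1 - \<xi> $ j" "0 \<le> 1 + \<xi> $ j"
      using less.prems(1)[rule_format, of j] by auto
    ultimately show ?thesis
      using mem[of 1] mem[of "-1"] by (simp add: convexD[OF C] field_simps)
  qed
qed

section \<open>Clarke gradients\<close>

text \<open>Pre-activations with the strict signs \<sigma> are prescribed first; the biases that
  produce them are computed afterwards.\<close>

lemma vertex_signature_realized:
  assumes \<sigma>: "\<forall>k. \<bar>\<sigma> $ k\<bar> = 1" and al: "aligned \<sigma> x"
  shows "\<exists>X. X \<longlonglongrightarrow> x \<and> (\<forall>n k. 0 < \<sigma> $ k * smooth_switching c \<sigma> (X n) $ k)"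
proof -
  define z where "z = switching c x"
  define e where "e n = inverse (real (Suc n))" for n
  \<comment> \<open>Only the kink components are pushed off 0, each towards its sign in
    \<sigma>.\<close>
  define y where "y n = z + e n *\<^sub>R (\<chi> k. if z $ k = 0 then \<sigma> $ k else 0)" for n
  \<comment> \<open>Adding the residual of \<open>y n\<close> to the hidden biases makes
    \<open>y n\<close> the exact solution at \<open>X n\<close>. The residual tends to 0 since
    \<open>z\<close> solves the equation at \<open>x\<close>.\<close>
  define X where "X n = x + bias_shift (y n - c x (diag \<sigma> *v y n) (y n))" for n
  have "c (X n) (diag \<sigma> *v y n) (y n) = y n" for n
    unfolding X_def linear_add[OF linear_c] c_bias_shift by simp
  then have y: "smooth_switching c \<sigma> (X n) = y n" for n
    by (intro smooth_switching_eqI) simp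
  have "e \<longlonglongrightarrow> 0"
    unfolding e_def by (rule LIMSEQ_inverse_real_of_nat)
  then have "y \<longlonglongrightarrow> z + 0 *\<^sub>R (\<chi> k. if z $ k = 0 then \<sigma> $ k else 0)"
    unfolding y_def by (intro tendsto_intros)
  then have lim: "y \<longlonglongrightarrow> z"
    by simp
  have "(\<lambda>n. c x (diag \<sigma> *v y n) (y n)) \<longlonglongrightarrow> c x (diag \<sigma> *v z) z"
  proof (rule vec_tendstoI)
    fix k
    show "(\<lambda>n. c x (diag \<sigma> *v y n) (y n) $ k) \<longlonglongrightarrow> c x (diag \<sigma> *v z) z $ k"
      unfolding c_nth diag_mult_nth using lim by (cases "layer k = 1") (auto intro!: tendsto_intros)
  qed
  moreover have "c x (diag \<sigma> *v z) z = z"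
    using aligned_smooth_switching[OF al] smooth_switching_fixpoint[of \<sigma> x] by (simp add: z_def)
  ultimately have "(\<lambda>n. y n - c x (diag \<sigma> *v y n) (y n)) \<longlonglongrightarrow> z - z"
    using lim by (intro tendsto_diff) simp_all
  then have "(\<lambda>n. bias_shift (y n - c x (diag \<sigma> *v y n) (y n))) \<longlonglongrightarrow> bias_shift (z - z)"
    using linear_linear[THEN iffD2, OF linear_bias_shift] by (rule bounded_linear.tendsto[rotated])
  then have "X \<longlonglongrightarrow> x + bias_shift (z - z)"
    unfolding X_def by (intro tendsto_intros)
  then have "X \<longlonglongrightarrow> x"
    by (simp add: linear_0[OF linear_bias_shift])
  moreover have "0 < \<sigma> $ k * smooth_switching c \<sigma> (X n) $ k" for n k
  proof (cases "z $ k = 0")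
    case True
    have "\<sigma> $ k * \<sigma> $ k = 1"
      using \<sigma> by (metis abs_mult_self_eq mult_1)
    then show ?thesis
      using True by (simp add: y y_def e_def mult.left_commute[of _ "e n"] field_simps)
  next
    case False
    then show ?thesis
      using al by (simp add: y y_def aligned_def z_def)
  qed
  ultimately show ?thesis
    by blast
qed

lemma smooth_model_gradient_in_clarke_gradients:
  assumes F: "has_C1_gradient (\<lambda>a. loss (h a) v) F'"
    and "\<forall>k. \<bar>\<xi> $ k\<bar> \<le> 1" and "aligned \<xi> x"
  shows "smooth_model_gradient F' \<xi> x \<in> clarke_gradients (\<lambda>x. loss (net T layer idx h u x) v) x"
proof (rule smooth_model_gradient_in_convex[OF _ _ assms(2,3)])
  let ?\<phi> = "\<lambda>x. loss (net T layer idx h u x) v"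
  show "convex (clarke_gradients ?\<phi> x)"
    by (simp add: clarke_gradients_def convex_convex_hull)
  fix \<sigma> assume \<sigma>: "\<forall>k. \<bar>\<sigma> $ k\<bar> = 1" and al: "aligned \<sigma> x"
  obtain X where X: "X \<longlonglongrightarrow> x" and pos: "\<And>n k. 0 < \<sigma> $ k * smooth_switching c \<sigma> (X n) $ k"
    using vertex_signature_realized[OF \<sigma> al] by blast
  \<comment> \<open>The strict signs cut out an open set on which the objective equals the smooth
    model of \<sigma>; thus the objective is differentiable at each \<open>X n\<close> with the
    gradient of that model.\<close>
  define U where "U = (\<Inter>k. {x'. 0 < \<sigma> $ k * smooth_switching c \<sigma> x' $ k})"
  have "open U"
    unfolding U_def
    by (intro open_INT ballI open_Collect_less continuous_intros
        has_C1_gradient_continuous[OF has_C1_gradient_smooth_switching]) auto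
  have U: "loss (h (smooth_output \<sigma> x')) v = ?\<phi> x'" if "x' \<in> U" for x'
  proof -
    have "\<sigma> $ k * smooth_switching c \<sigma> x' $ k = \<bar>smooth_switching c \<sigma> x' $ k\<bar>" for k
      using that \<sigma> by (simp add: U_def) (metis abs_mult abs_of_pos mult_1)
    then show ?thesis
      using aligned_net[OF alignedI] by metis
  qed
  have C1: "has_C1_gradient (\<lambda>x. loss (h (smooth_output \<sigma> x)) v) (smooth_model_gradient F' \<sigma>)"
    using has_C1_gradient_smooth_model[OF F] .
  have "GDERIV ?\<phi> (X n) :> smooth_model_gradient F' \<sigma> (X n)" for n
    unfolding gderiv_def
  proof (rule has_derivative_transform_within_open[OF _ \<open>open U\<close> _ U])
    show "((\<lambda>x. loss (h (smooth_output \<sigma> x)) v) has_derivative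
        (\<lambda>d. d \<bullet> smooth_model_gradient F' \<sigma> (X n))) (at (X n))"
      using C1 unfolding has_C1_gradient_def gderiv_def by blast
    show "X n \<in> U"
      using pos by (simp add: U_def)
  qed
  moreover have "(\<lambda>n. smooth_model_gradient F' \<sigma> (X n)) \<longlonglongrightarrow> smooth_model_gradient F' \<sigma> x"
    using C1 unfolding has_C1_gradient_def
    by (intro continuous_on_tendsto_compose[of UNIV, OF _ X]) simp_all
  \<comment> \<open>At a vertex the gradient is itself a limit of gradients; the convex hull enters
    only through the reduction to vertices.\<close>
  ultimately show "smooth_model_gradient F' \<sigma> x \<in> clarke_gradients ?\<phi> x"
    unfolding clarke_gradients_def using X by (intro hull_inc CollectI exI conjI allI)
qed

end

theorem mainTheorem5:
  fixes J T :: nat and N :: "nat \<Rightarrow> nat"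
    and layer :: "'h::finite \<Rightarrow> nat"
    and idx :: "('i::finite, 'h, 'm::finite) neuron parameter \<Rightarrow> 'n::finite"
    and h :: "real ^ 'm \<Rightarrow> real ^ 'm"
    and loss :: "real ^ 'm \<Rightarrow> real ^ 'm \<Rightarrow> real"
    and u :: "nat \<Rightarrow> real ^ 'i" and v :: "nat \<Rightarrow> real ^ 'm"
  assumes "J \<ge> 1" and "T \<ge> 1"
    and "N 0 = CARD('i)" and "N (T + 1) = CARD('m)"
    and "\<forall>t\<in>{1..T}. N t \<ge> 1"
    and "\<forall>k. layer k \<in> {1..T}"
    and "\<forall>t\<in>{1..T}. card {k. layer k = t} = N t"
    and "bij_betw idx (parameters T layer) UNIV"
    and "smooth h" and "\<forall>w. C_k 2 (\<lambda>a. loss a w)"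
  shows "\<forall>j\<in>{1..J}. \<forall>x :: real ^ 'n.
      LIKQ (net_c layer idx (u j)) x \<and>
      (\<forall>\<xi> :: real ^ 'h.
         (\<forall>k. \<xi> $ k \<in> {-1..1}) \<and>
         (\<forall>k. signature (switching (net_c layer idx (u j)) x) $ k \<noteq> 0 \<longrightarrow>
              \<xi> $ k = signature (switching (net_c layer idx (u j)) x) $ k) \<longrightarrow>
         (\<exists>g. GDERIV (smooth_model (net_f T layer idx h loss (v j)) (net_c layer idx (u j)) \<xi>) x :> g \<and>
              g \<in> clarke_gradients (\<lambda>x'. loss (net T layer idx h (u j) x') (v j)) x))"
proof (intro ballI allI conjI impI)
  fix j and x :: "real ^ 'n"
  interpret relu_network T layer idx "u j"
    using assms by unfold_locales auto
  show "LIKQ (net_c layer idx (u j)) x"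
    by (rule LIKQ_net_c)
  fix \<xi> :: "real ^ 'h"
  assume \<xi>: "(\<forall>k. \<xi> $ k \<in> {-1..1}) \<and>
    (\<forall>k. signature (switching (net_c layer idx (u j)) x) $ k \<noteq> 0 \<longrightarrow>
      \<xi> $ k = signature (switching (net_c layer idx (u j)) x) $ k)"
  have al: "aligned \<xi> x"
    unfolding aligned_def
  proof
    fix k
    show "\<xi> $ k * switching (net_c layer idx (u j)) x $ k = \<bar>switching (net_c layer idx (u j)) x $ k\<bar>"
      \<comment> \<open>At a kink both sides are 0; elsewhere \<open>\<xi> $ k\<close> is the sign
        of the pre-activation.\<close>
      using conjunct2[OF \<xi>, rule_format, of k]
      by (cases "switching (net_c layer idx (u j)) x $ k = 0")
        (simp_all add: signature_def sgn_zero_iff abs_sgn mult.commute)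
  qed
  have "C_k (Suc 0) h"
    using \<open>smooth h\<close> by (simp add: smooth_def del: C_k.simps)
  moreover have "C_k (Suc (Suc 0)) (\<lambda>a. loss a (v j))"
    using assms by (simp add: numeral_2_eq_2 del: C_k.simps)
  ultimately obtain F' where F': "has_C1_gradient (\<lambda>a. loss (h a) (v j)) F'"
    using C_k_compose_has_C1_gradient by blast
  have "GDERIV (smooth_model (net_f T layer idx h loss (v j)) (net_c layer idx (u j)) \<xi>) x :>
      smooth_model_gradient F' \<xi> x"
    using has_C1_gradient_smooth_model[OF F'] by (simp add: has_C1_gradient_def smooth_model_eq)
  moreover have "smooth_model_gradient F' \<xi> x \<in>
      clarke_gradients (\<lambda>x'. loss (net T layer idx h (u j) x') (v j)) x"
    using \<xi>
    by (intro smooth_model_gradient_in_clarke_gradients[where loss = loss and h = h] F' al)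
      (simp add: abs_le_iff minus_le_iff)
  ultimately show "\<exists>g. GDERIV (smooth_model (net_f T layer idx h loss (v j)) (net_c layer idx (u j)) \<xi>) x :> g \<and>
      g \<in> clarke_gradients (\<lambda>x'. loss (net T layer idx h (u j) x') (v j)) x"
    by (intro exI conjI)
qed

end
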